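(* Let $k\ge 2$ and $l\le k-1$ be integers, and let $X$ be a non trivial real Hamiltonian polynomial vector field of the form $$X=X_{lin}+X_k+X_{k+1}+\dots+X_{2l}.$$ Then $X$ is nonisochronous.
   Context: Planar real vector fields are written in complex form: $\mathbb{R}^2$ is identified with $\mathbb{C}$ by the complex coordinate $x$, with conjugate $\bar x$. Set $X_{lin}=i(x\partial_x-\bar x\partial_{\bar x})$ and, for $r\ge 2$, $X_r=P_r(x,\bar x)\partial_x+\overline{P_r(x,\bar x)}\,\partial_{\bar x}$, where $P_r(x,\bar x)=\sum_{j=0}^{r}p_{r-j-1,j}\,x^{r-j}\bar x^{j}$ is homogeneous of degree $r$ with complex coefficients. The field is real Hamiltonian if, in real coordinates $x=u+iv$, it is of the form $-\partial_vH\,\partial_u+\partial_uH\,\partial_v$ for a real polynomial $H(u,v)$. Non trivial means that $X\ne X_{lin}$. The origin is then a center. It is isochronous if all periodic orbits in a neighbourhood of the origin have the same period, and $X$ is called nonisochronous if its center at the origin is not isochronous. *)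

theory Defs
  imports "HOL-Analysis.Analysis"
begin

text \<open>
  A real planar vector field \<open>P \<partial>\<^sub>x + cnj P \<partial>\<^sub>x\<^sub>b\<^sub>a\<^sub>r\<close> in the complex coordinate \<open>x = u + iv\<close> is
  represented by its \<open>\<partial>\<^sub>x\<close>-component \<open>P :: complex \<Rightarrow> complex\<close>. The associated differential
  equation is \<open>x' = P x\<close>, that is, \<open>u' = Re (P x)\<close> and \<open>v' = Im (P x)\<close>.
\<close>

definition X_lin :: "complex \<Rightarrow> complex" where
  "X_lin x = \<i> * x"

text \<open>The first index of a coefficient is an integer since it equals \<open>-1\<close> for \<open>j = r\<close>.\<close>

definition X_hom :: "(int \<Rightarrow> nat \<Rightarrow> complex) \<Rightarrow> nat \<Rightarrow> complex \<Rightarrow> complex" where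
  "X_hom p r x = (\<Sum>j=0..r. p (int r - int j - 1) j * x ^ (r - j) * cnj x ^ j)"

definition real_hamiltonian :: "(complex \<Rightarrow> complex) \<Rightarrow> bool" where
  "real_hamiltonian X \<longleftrightarrow>
    (\<exists>H :: real \<times> real \<Rightarrow> real. real_polynomial_function H \<and>
      (\<forall>u v. ((\<lambda>t. H (u, t)) has_real_derivative - Re (X (Complex u v))) (at v) \<and>
             ((\<lambda>s. H (s, v)) has_real_derivative Im (X (Complex u v))) (at u)))"

text \<open>
  \<open>T\<close> is the minimal positive period, so \<open>\<gamma>\<close> is not constant.
\<close>

definition periodic_orbit :: "(complex \<Rightarrow> complex) \<Rightarrow> (real \<Rightarrow> complex) \<Rightarrow> real \<Rightarrow> bool" where
  "periodic_orbit X \<gamma> T \<longleftrightarrow>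
    (\<forall>t. (\<gamma> has_vector_derivative X (\<gamma> t)) (at t)) \<and>
    0 < T \<and> (\<forall>t. \<gamma> (t + T) = \<gamma> t) \<and>
    (\<forall>S. 0 < S \<and> S < T \<longrightarrow> (\<exists>t. \<gamma> (t + S) \<noteq> \<gamma> t))"

definition center_at_origin :: "(complex \<Rightarrow> complex) \<Rightarrow> bool" where
  "center_at_origin X \<longleftrightarrow> X 0 = 0 \<and>
    (\<exists>U. open U \<and> 0 \<in> U \<and>
      (\<forall>z\<in>U - {0}. \<exists>\<gamma> T. periodic_orbit X \<gamma> T \<and> z \<in> range \<gamma> \<and> range \<gamma> \<subseteq> U))"

definition isochronous :: "(complex \<Rightarrow> complex) \<Rightarrow> bool" where
  "isochronous X \<longleftrightarrow>
    (\<exists>U T. open U \<and> 0 \<in> U \<and>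
      (\<forall>\<gamma> S. periodic_orbit X \<gamma> S \<and> range \<gamma> \<subseteq> U \<longrightarrow> S = T))"

definition nonisochronous :: "(complex \<Rightarrow> complex) \<Rightarrow> bool" where
  "nonisochronous X \<longleftrightarrow> center_at_origin X \<and> \<not> isochronous X"

end

theory Submission
  imports Defs
begin

text \<open>
  Let \<open>H\<close> be the Hamiltonian and write \<open>x = \<rho> cis \<theta>\<close>. The field
  rotates about the origin: \<open>\<theta>' = Im (X x / x) = 1 + (\<Sum>s. \<rho>^s a\<^sub>s \<theta>)\<close>, where \<open>a\<^sub>s\<close> comes from the
  homogeneous part of degree \<open>s + 1\<close>, and \<open>\<rho> \<theta>'\<close> is also the radial derivative of \<open>H\<close>. Hence
  \<open>H - H 0 = \<rho>\<^sup>2/2 + (\<Sum>s. \<rho>^(s+2) a\<^sub>s \<theta> / (s+2))\<close>. Near the origin \<open>H\<close> is strictly increasing along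
  rays, so each small level set \<open>H = H 0 + e\<^sup>2/2\<close> is a closed curve \<open>\<rho> = R e \<theta>\<close> around the origin
  and carries a periodic orbit whose minimal period is the integral of \<open>1/\<theta>'\<close> over one turn. This
  makes the origin a center. No existence theorem for differential equations enters: the orbit is
  the curve reparametrised by the inverse of the travel time
  (\<open>periodic_orbit_of_closed_polar_curve\<close>).

  If all \<open>a\<^sub>s\<close> vanished, \<open>H\<close> would be \<open>\<rho>\<^sup>2/2\<close> up to a constant and \<open>X\<close> would be linear. Let \<open>q\<close> be the
  least index with \<open>a\<^sub>q \<noteq> 0\<close>. Solving for \<open>R\<close> to second order gives, uniformly in \<open>\<theta>\<close>,
  \<open>1/\<theta>' = 1 - (\<Sum>s. e^s a\<^sub>s \<theta>) + c e^(2 q) (a\<^sub>q \<theta>)\<^sup>2 + O(e^(2 q + 1))\<close> with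
  \<open>c = (2 q + 2)/(q + 2) > 0\<close> (\<open>angular_slowness_expansion\<close>). The degree bound says exactly that the
  linear terms have exponents \<open>s < 2 q\<close>, so they cannot interfere with the quadratic one. If the
  period did not depend on \<open>e\<close>, integration over \<open>\<theta>\<close> would produce a polynomial in \<open>e\<close> of degree at
  most \<open>2 q\<close> that is \<open>O(e^(2 q + 1))\<close>, hence zero; its coefficient at \<open>e^(2 q)\<close> is \<open>-c\<close> times the
  integral of \<open>a\<^sub>q\<^sup>2\<close>, and that integral is positive. This contradiction shows that the center is not isochronous.
\<close>

section \<open>Periodic orbits from closed polar curves\<close>

text \<open>
  The field is tangent to the curve and moves along it with angular speed \<open>w\<close>. The travel time
  \<open>\<tau>\<close>, an antiderivative of \<open>1/w\<close>, is a bijection of the real line, and its inverse \<open>\<Theta>\<close> turns the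
  curve into a solution. The period is minimal because \<open>\<Theta>\<close> is strictly increasing and gains \<open>2 pi\<close>
  per period: a shorter return would make two angles that differ by less than a full turn give
  the same point.
\<close>

lemma periodic_orbit_of_closed_polar_curve:
  fixes X :: "complex \<Rightarrow> complex" and R w :: "real \<Rightarrow> real" and z z' :: "real \<Rightarrow> complex"
  assumes polar: "\<And>\<theta>. z \<theta> = of_real (R \<theta>) * cis \<theta>" and R_pos: "\<And>\<theta>. R \<theta> > 0"
    and dz: "\<And>\<theta>. (z has_vector_derivative z' \<theta>) (at \<theta>)"
    and cont_w: "continuous_on UNIV w" and w_pos: "\<And>\<theta>. w \<theta> > 0"
    and R_per: "\<And>\<theta>. R (\<theta> + 2 * pi) = R \<theta>" and w_per: "\<And>\<theta>. w (\<theta> + 2 * pi) = w \<theta>"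
    and tangent: "\<And>\<theta>. X (z \<theta>) = w \<theta> *\<^sub>R z' \<theta>"
  shows "\<exists>\<gamma> T. periodic_orbit X \<gamma> T \<and> ((\<lambda>\<theta>. 1 / w \<theta>) has_integral T) {0..2*pi} \<and> range \<gamma> = range z"
proof -
  have "isCont (\<lambda>\<theta>. 1 / w \<theta>) x" for x
    using cont_w w_pos[of x] by (auto simp: continuous_on_eq_continuous_at intro!: continuous_intros)
  then obtain \<tau> where \<tau>: "(\<tau> has_vector_derivative 1 / w x) (at x)" for x
    using einterval_antiderivative[of "-\<infinity>" "\<infinity>" "\<lambda>\<theta>. 1 / w \<theta>"] by auto
  have d\<tau>: "(\<tau> has_real_derivative 1 / w x) (at x)" for x
    using \<tau> by (simp add: has_real_derivative_iff_has_vector_derivative)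
  have mono: "\<tau> x < \<tau> y" if "x < y" for x y
    by (rule DERIV_pos_imp_increasing[OF that]) (use d\<tau> w_pos in \<open>force intro!: exI\<close>)
  define T where "T = \<tau> (2 * pi) - \<tau> 0"
  have T_integral: "((\<lambda>\<theta>. 1 / w \<theta>) has_integral T) {0..2*pi}"
    unfolding T_def
    by (rule fundamental_theorem_of_calculus) (auto intro: has_vector_derivative_at_within \<tau>)
  have "((\<lambda>\<theta>. \<tau> (\<theta> + 2 * pi) - \<tau> \<theta>) has_real_derivative 0) (at x)" for x
  proof -
    have "((\<lambda>\<theta>. \<tau> (\<theta> + 2 * pi)) has_real_derivative 1 / w (x + 2 * pi)) (at x)"
      using d\<tau>[of "x + 2 * pi"] by (simp add: DERIV_shift)
    from DERIV_diff[OF this d\<tau>[of x]] show ?thesis by (simp add: w_per)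
  qed
  then have "\<tau> (x + 2 * pi) - \<tau> x = \<tau> (0 + 2 * pi) - \<tau> 0" for x
    using DERIV_isconst_all by blast
  then have shift: "\<tau> (x + 2 * pi) = \<tau> x + T" for x
    using T_def by (smt (verit))
  have shift_nat: "\<tau> (x + real n * (2 * pi)) = \<tau> x + real n * T" for x n
  proof (induction n)
    case (Suc n)
    have "\<tau> (x + real (Suc n) * (2 * pi)) = \<tau> ((x + real n * (2 * pi)) + 2 * pi)"
      by (simp add: algebra_simps)
    also have "\<dots> = \<tau> (x + real n * (2 * pi)) + T" by (rule shift)
    finally show ?case using Suc by (simp add: algebra_simps)
  qed simp
  have T_pos: "T > 0" using T_def mono[of 0 "2 * pi"] by simp
  have surj: "\<exists>x. \<tau> x = t" for t
  proof -
    obtain n where n: "\<bar>t - \<tau> 0\<bar> < real n * T"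
      using reals_Archimedean3[OF T_pos] by blast
    have "\<tau> (real n * (2 * pi)) = \<tau> 0 + real n * T"
      using shift_nat[of 0 n] by simp
    moreover have "\<tau> 0 = \<tau> (- (real n * (2 * pi))) + real n * T"
      using shift_nat[of "- (real n * (2 * pi))" n] by simp
    moreover have "continuous_on {- (real n * (2 * pi))..real n * (2 * pi)} \<tau>"
      using d\<tau> DERIV_isCont by (metis continuous_at_imp_continuous_on)
    ultimately show ?thesis
      using IVT'[of \<tau> "- (real n * (2 * pi))" t "real n * (2 * pi)"] n
      by (smt (verit) of_nat_0_le_iff pi_gt_zero mult_nonneg_nonneg)
  qed
  have inj: "inj \<tau>"
    by (metis injI linorder_neq_iff mono)
  define \<Theta> where "\<Theta> = inv \<tau>"
  have \<Theta>_\<tau>: "\<Theta> (\<tau> x) = x" for x unfolding \<Theta>_def by (simp add: inj)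
  have \<tau>_\<Theta>: "\<tau> (\<Theta> t) = t" for t unfolding \<Theta>_def by (metis surj f_inv_into_f rangeI)
  have d\<Theta>: "(\<Theta> has_real_derivative w (\<Theta> t)) (at t)" for t
  proof -
    have "(\<Theta> has_derivative (*) (w (\<Theta> t))) (at t)"
    proof (rule has_derivative_inverse_strong_x[where S = UNIV and f = \<tau>])
      show "continuous_on UNIV \<tau>"
        using d\<tau> DERIV_isCont by (metis continuous_at_imp_continuous_on)
      show "(\<tau> has_derivative (*) (1 / w (\<Theta> t))) (at (\<Theta> t))"
        using d\<tau> by (simp add: has_field_derivative_def)
      show "(*) (1 / w (\<Theta> t)) \<circ> (*) (w (\<Theta> t)) = id"
        using w_pos[of "\<Theta> t"] by (auto simp: fun_eq_iff)
    qed (use \<Theta>_\<tau> \<tau>_\<Theta> in auto)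
    then show ?thesis by (simp add: has_field_derivative_def)
  qed
  have \<Theta>_shift: "\<Theta> (t + T) = \<Theta> t + 2 * pi" for t
    by (metis \<Theta>_\<tau> \<tau>_\<Theta> shift)
  have \<Theta>_mono: "\<Theta> s < \<Theta> t" if "s < t" for s t
    by (metis \<tau>_\<Theta> linorder_less_linear mono order_less_imp_not_less that)
  have z_per: "z (\<theta> + 2 * pi) = z \<theta>" for \<theta>
    by (simp add: polar R_per flip: cis_mult)
  define \<gamma> where "\<gamma> = z \<circ> \<Theta>"
  have "range \<Theta> = UNIV" using \<Theta>_\<tau> by (metis surjI)
  then have range: "range \<gamma> = range z" by (simp add: \<gamma>_def image_comp flip: image_image)
  have "(\<gamma> has_vector_derivative X (\<gamma> t)) (at t)" for t
  proof -
    have "((z \<circ> \<Theta>) has_vector_derivative w (\<Theta> t) *\<^sub>R z' (\<Theta> t)) (at t)"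
      by (rule vector_diff_chain_at)
        (use d\<Theta> dz in \<open>auto simp: has_real_derivative_iff_has_vector_derivative\<close>)
    then show ?thesis by (simp add: \<gamma>_def tangent)
  qed
  moreover have "\<gamma> (t + T) = \<gamma> t" for t
    by (simp add: \<gamma>_def \<Theta>_shift z_per)
  moreover have "\<exists>t. \<gamma> (t + S) \<noteq> \<gamma> t" if S: "0 < S" "S < T" for S
  proof
    show "\<gamma> (0 + S) \<noteq> \<gamma> 0"
    proof
      assume eq: "\<gamma> (0 + S) = \<gamma> 0"
      let ?a = "\<Theta> S" and ?b = "\<Theta> 0"
      have ab: "?b < ?a" "?a < ?b + 2 * pi"
        using \<Theta>_mono[of 0 S] \<Theta>_mono[of S T] \<Theta>_shift[of 0] S by auto
      have e: "of_real (R ?a) * cis ?a = of_real (R ?b) * cis ?b"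
        using eq by (simp add: \<gamma>_def polar)
      from arg_cong[OF this, of norm] have "R ?a = R ?b"
        using R_pos[of ?a] R_pos[of ?b] by (simp add: norm_mult)
      with e R_pos[of ?b] have "cis ?a = cis ?b" by auto
      then have "cis (?a - ?b) = 1"
        by (simp flip: cis_divide)
      then have "cos (?a - ?b) = 1"
        by (metis cis.simps(1) one_complex.simps(1))
      then obtain n :: int where "?a - ?b = of_int n * 2 * pi"
        using cos_one_2pi_int by (auto simp: algebra_simps)
      with ab have "0 < of_int n * (2 * pi)" "of_int n * (2 * pi) < 1 * (2 * pi)"
        by linarith+
      then have "0 < real_of_int n" "real_of_int n < 1"
        using pi_gt_zero mult_less_cancel_right_pos[of "2 * pi" "real_of_int n" 1]
        by (auto simp only: zero_less_mult_iff)
      then show False by simp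
    qed
  qed
  ultimately have "periodic_orbit X \<gamma> T"
    using T_pos unfolding periodic_orbit_def by blast
  with range T_integral show ?thesis by blast
qed

section \<open>Rotating Hamiltonian fields have a center\<close>

text \<open>
  The two partial derivatives of the Hamiltonian combine into a single real-linear form, since
  \<open>Im (X cnj h) = Im X Re h - Re X Im h\<close>. They determine the total derivative because
  a polynomial function is differentiable.
\<close>

lemma real_hamiltonian_complex_gradient:
  assumes "real_hamiltonian X"
  obtains H :: "complex \<Rightarrow> real"
  where "\<And>z. (H has_derivative (\<lambda>h. Im (X z * cnj h))) (at z)"
proof -
  obtain H0 :: "real \<times> real \<Rightarrow> real" where poly: "real_polynomial_function H0"
    and dv: "\<And>u v. ((\<lambda>t. H0 (u, t)) has_real_derivative - Re (X (Complex u v))) (at v)"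
    and du: "\<And>u v. ((\<lambda>s. H0 (s, v)) has_real_derivative Im (X (Complex u v))) (at u)"
    using assms unfolding real_hamiltonian_def by blast
  have "((\<lambda>z. H0 (Re z, Im z)) has_derivative (\<lambda>h. Im (X z * cnj h))) (at z)" for z
  proof -
    obtain D where D: "(H0 has_derivative D) (at (Re z, Im z))"
      using differentiable_at_real_polynomial_function[OF poly] unfolding differentiable_def by blast
    have "((\<lambda>s. H0 (s, Im z)) has_derivative (\<lambda>a. D (a, 0))) (at (Re z))"
      by (rule has_derivative_compose[of "\<lambda>s. (s, Im z)" _ _ _ H0, OF _ D])
        (auto intro!: derivative_eq_intros)
    from has_derivative_unique[OF this du[of "Im z" "Re z", unfolded has_field_derivative_def]]
    have D1: "D (a, 0) = Im (X z) * a" for a by (simp add: fun_eq_iff)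
    have "((\<lambda>t. H0 (Re z, t)) has_derivative (\<lambda>b. D (0, b))) (at (Im z))"
      by (rule has_derivative_compose[of "\<lambda>t. (Re z, t)" _ _ _ H0, OF _ D])
        (auto intro!: derivative_eq_intros)
    from has_derivative_unique[OF this dv[of "Re z", unfolded has_field_derivative_def]]
    have D2: "D (0, b) = - Re (X z) * b" for b by (simp add: fun_eq_iff)
    have "linear D" using D has_derivative_linear by blast
    then have "D (a, b) = Im (X z) * a - Re (X z) * b" for a b
      using linear_add[of D "(a, 0)" "(0, b)"] by (simp add: D1 D2)
    moreover have "((\<lambda>z. H0 (Re z, Im z)) has_derivative (\<lambda>h. D (Re h, Im h))) (at z)"
      by (rule has_derivative_compose[of "\<lambda>z. (Re z, Im z)" _ _ _ H0, OF _ D])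
        (auto intro!: derivative_eq_intros)
    moreover have "Im (X z * cnj h) = Im (X z) * Re h - Re (X z) * Im h" for h
      by simp
    ultimately show ?thesis by simp
  qed
  then show thesis by (rule that)
qed

text \<open>
  \<open>Im (X z / z)\<close> is the angular speed at \<open>z\<close> of the motion along the field, and
  \<open>H_deriv\<close> says that \<open>X\<close> is \<open>\<i>\<close> times the gradient of \<open>H\<close>.
\<close>

locale rotating_hamiltonian_field =
  fixes X :: "complex \<Rightarrow> complex" and H :: "complex \<Rightarrow> real" and \<delta> :: real
  assumes H_deriv: "\<And>z. (H has_derivative (\<lambda>h. Im (X z * cnj h))) (at z)"
    and X_cont: "continuous_on UNIV X" and X_0: "X 0 = 0"
    and \<delta>_pos: "\<delta> > 0"
    and rotation: "\<And>z. \<lbrakk>z \<noteq> 0; norm z < \<delta>\<rbrakk> \<Longrightarrow> Im (X z / z) > 0"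
begin

lemma H_radial_deriv:
  "((\<lambda>\<rho>. H (of_real \<rho> * cis \<theta>)) has_real_derivative
     \<rho> * Im (X (of_real \<rho> * cis \<theta>) / (of_real \<rho> * cis \<theta>))) (at \<rho>)"
proof -
  have "((\<lambda>\<rho>. H (of_real \<rho> * cis \<theta>)) has_derivative
     (\<lambda>d. Im (X (of_real \<rho> * cis \<theta>) * cnj (of_real d * cis \<theta>)))) (at \<rho>)"
    by (rule has_derivative_compose[of "\<lambda>\<rho>. of_real \<rho> * cis \<theta>" _ _ _ H, OF _ H_deriv])
      (auto intro!: derivative_eq_intros)
  moreover have "Im (X (of_real \<rho> * cis \<theta>) * cnj (of_real d * cis \<theta>))
      = \<rho> * Im (X (of_real \<rho> * cis \<theta>) / (of_real \<rho> * cis \<theta>)) * d" for d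
  proof (cases "\<rho> = 0")
    case False
    have "u / (of_real \<rho> * cis \<theta>) = of_real (1 / \<rho>) * (u * cis (- \<theta>))" for u
      using False by (simp add: field_simps cis_mult)
    then show ?thesis
      using False by (simp add: cis_cnj mult.left_commute[of _ "of_real d"])
  qed (simp add: X_0)
  ultimately show ?thesis by (simp add: has_field_derivative_def)
qed

lemma H_radial_strict_mono:
  assumes "0 \<le> a" "a < b" "b < \<delta>"
  shows "H (of_real a * cis \<theta>) < H (of_real b * cis \<theta>)"
proof (rule DERIV_pos_imp_increasing_open[OF \<open>a < b\<close>])
  fix \<rho> assume \<rho>: "a < \<rho>" "\<rho> < b"
  then have "\<rho> * Im (X (of_real \<rho> * cis \<theta>) / (of_real \<rho> * cis \<theta>)) > 0"
    using assms by (intro mult_pos_pos rotation) (auto simp: norm_mult)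
  then show "\<exists>y. ((\<lambda>\<rho>. H (of_real \<rho> * cis \<theta>)) has_real_derivative y) (at \<rho>) \<and> 0 < y"
    using H_radial_deriv by blast
next
  show "continuous_on {a..b} (\<lambda>\<rho>. H (of_real \<rho> * cis \<theta>))"
    using H_radial_deriv DERIV_isCont by (metis continuous_at_imp_continuous_on)
qed

lemma H_radial_inj:
  assumes "0 \<le> a" "a < \<delta>" "0 \<le> b" "b < \<delta>"
    and "H (of_real a * cis \<theta>) = H (of_real b * cis \<theta>)"
  shows "a = b"
  using H_radial_strict_mono[of a b \<theta>] H_radial_strict_mono[of b a \<theta>] assms
  by (cases a b rule: linorder_cases) auto

text \<open>
  The map \<open>(\<rho>, \<theta>) \<mapsto> (H (\<rho> cis \<theta>), \<theta>)\<close> is injective with invertible derivative on a punctured disc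
  in polar coordinates, and its inverse sends \<open>(E, \<theta>)\<close> to \<open>(R \<theta>, \<theta>)\<close>. So the inverse function theorem
  makes \<open>R\<close> differentiable. The derivative is the one of \<open>\<rho>\<close> by \<open>\<theta>\<close> along the flow.
\<close>

lemma level_curve_deriv:
  assumes R: "\<And>\<theta>. 0 < R \<theta>" "\<And>\<theta>. R \<theta> < \<delta>" and level: "\<And>\<theta>. H (of_real (R \<theta>) * cis \<theta>) = E"
  defines "z \<equiv> \<lambda>\<theta>. of_real (R \<theta>) * cis \<theta>"
  shows "(R has_real_derivative R \<theta> * Re (X (z \<theta>) / z \<theta>) / Im (X (z \<theta>) / z \<theta>)) (at \<theta>)"
proof -
  define S where "S = {0<..<\<delta>} \<times> (UNIV :: real set)"
  define f where "f = (\<lambda>(\<rho>, \<theta>). (H (of_real \<rho> * cis \<theta>), \<theta> :: real))"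
  have inj: "inj_on f S"
    by (auto simp: inj_on_def f_def S_def intro: H_radial_inj)
  define g where "g = inv_into S f"
  have g_f: "g (f x) = x" if "x \<in> S" for x
    using that inj by (simp add: g_def)
  have f_R: "f (R \<theta>, \<theta>) = (E, \<theta>)" for \<theta>
    by (simp add: f_def level)
  have g_E: "g (E, \<theta>) = (R \<theta>, \<theta>)" for \<theta>
    using g_f[of "(R \<theta>, \<theta>)"] R by (simp add: f_R S_def)
  have df: "(f has_derivative (\<lambda>(d, t). (Im (X (of_real \<rho> * cis \<theta>) *
      cnj (of_real d * cis \<theta> + of_real \<rho> * (t *\<^sub>R (\<i> * cis \<theta>)))), t))) (at (\<rho>, \<theta>))" for \<rho> \<theta>
  proof -
    have "((\<lambda>x. of_real (fst x) * cis (snd x)) has_derivative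
        (\<lambda>x. of_real (fst x) * cis \<theta> + of_real \<rho> * (snd x *\<^sub>R (\<i> * cis \<theta>)))) (at (\<rho>, \<theta>))"
      by (rule derivative_eq_intros refl | simp add: add.commute)+
    from has_derivative_compose[OF this, of H "\<lambda>h. Im (X (of_real \<rho> * cis \<theta>) * cnj h)"] H_deriv
    have "((\<lambda>x. H (of_real (fst x) * cis (snd x))) has_derivative
        (\<lambda>x. Im (X (of_real \<rho> * cis \<theta>) *
          cnj (of_real (fst x) * cis \<theta> + of_real \<rho> * (snd x *\<^sub>R (\<i> * cis \<theta>)))))) (at (\<rho>, \<theta>))"
      by simp
    then show ?thesis
      unfolding f_def case_prod_unfold by (intro has_derivative_Pair) (auto intro: derivative_eq_intros)
  qed
  let ?a = "Re (X (z \<theta>) / z \<theta>)" and ?w = "Im (X (z \<theta>) / z \<theta>)"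
  have z_nz: "z \<theta> \<noteq> 0" using R[of \<theta>] by (simp add: z_def)
  have w_pos: "?w > 0"
    by (rule rotation) (use z_nz R[of \<theta>] in \<open>auto simp: z_def norm_mult\<close>)
  have Xz: "X (z \<theta>) = (of_real ?a + \<i> * of_real ?w) * of_real (R \<theta>) * cis \<theta>"
    using z_nz by (simp add: z_def flip: complex_eq)
  have cnj_cis: "cis \<theta> * cis (- \<theta>) = 1" by (simp add: cis_mult)
  have comp: "X (z \<theta>) * cnj (of_real d * cis \<theta> + of_real (R \<theta>) * (t *\<^sub>R (\<i> * cis \<theta>)))
       = of_real (R \<theta>) * (of_real ?a + \<i> * of_real ?w) * (of_real d - \<i> * of_real (R \<theta> * t))" for d t
  proof -
    have "X (z \<theta>) * cnj (of_real d * cis \<theta> + of_real (R \<theta>) * (t *\<^sub>R (\<i> * cis \<theta>)))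
       = (of_real ?a + \<i> * of_real ?w) * of_real (R \<theta>) * (cis \<theta> * cis (- \<theta>)) *
         (of_real d - \<i> * of_real (R \<theta> * t))"
      by (subst Xz) (simp add: cis_cnj scaleR_conv_of_real algebra_simps)
    then show ?thesis by (simp add: cnj_cis mult_ac)
  qed
  \<comment> \<open>The inverse of \<open>(d, t) \<mapsto> (R \<theta> (?w d - ?a R \<theta> t), t)\<close>, which is the derivative of \<open>f\<close> by \<open>comp\<close>.\<close>
  define g' where "g' = (\<lambda>(d, t :: real). ((d / R \<theta> + ?a * R \<theta> * t) / ?w, t))"
  have "(g has_derivative g') (at (E, \<theta>))"
  proof (rule has_derivative_inverse_strong_x)
    show "open S" unfolding S_def by (intro open_Times) auto
    show "g (E, \<theta>) \<in> S" using R by (simp add: g_E S_def)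
    show "continuous_on S f"
      using df by (auto intro!: continuous_at_imp_continuous_on has_derivative_continuous)
    show "(f has_derivative (\<lambda>(d, t). (Im (X (of_real (R \<theta>) * cis \<theta>) *
        cnj (of_real d * cis \<theta> + of_real (R \<theta>) * (t *\<^sub>R (\<i> * cis \<theta>)))), t))) (at (g (E, \<theta>)))"
      unfolding g_E by (rule df)
    show "(\<lambda>(d, t). (Im (X (of_real (R \<theta>) * cis \<theta>) *
        cnj (of_real d * cis \<theta> + of_real (R \<theta>) * (t *\<^sub>R (\<i> * cis \<theta>)))), t)) \<circ> g' = id"
      unfolding comp[unfolded z_def] fun_eq_iff
      using w_pos R[of \<theta>] by (auto simp: g'_def z_def field_simps)
    show "f (g (E, \<theta>)) = (E, \<theta>)" by (simp add: g_E f_R)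
  qed (rule g_f)
  from has_derivative_compose[of "\<lambda>\<theta>. (E, \<theta>)" "\<lambda>t. (0, t)" \<theta> UNIV g, OF _ this]
  have "((\<lambda>\<theta>. g (E, \<theta>)) has_derivative (\<lambda>t. g' (0, t))) (at \<theta>)"
    by (simp add: has_derivative_Pair)
  from has_derivative_fst[OF this] have "(R has_derivative (\<lambda>t. ?a * R \<theta> * t / ?w)) (at \<theta>)"
    by (simp add: g_E g'_def)
  then show ?thesis
    by (rule has_derivative_imp_has_field_derivative) (simp add: mult_ac)
qed

text \<open>
  The level curve is closed because \<open>R\<close> inherits the period \<open>2 pi\<close> from radial injectivity, and by
  \<open>level_curve_deriv\<close> the field is tangent to it.
\<close>

lemma level_curve_orbit:
  assumes R: "\<And>\<theta>. 0 < R \<theta>" "\<And>\<theta>. R \<theta> < \<delta>" and level: "\<And>\<theta>. H (of_real (R \<theta>) * cis \<theta>) = E"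
    and z_def: "\<And>\<theta>. z \<theta> = of_real (R \<theta>) * cis \<theta>"
  shows "\<exists>\<gamma> T. periodic_orbit X \<gamma> T \<and>
    ((\<lambda>\<theta>. 1 / Im (X (z \<theta>) / z \<theta>)) has_integral T) {0..2*pi} \<and> range \<gamma> = range z"
proof -
  let ?a = "\<lambda>\<theta>. Re (X (z \<theta>) / z \<theta>)" and ?w = "\<lambda>\<theta>. Im (X (z \<theta>) / z \<theta>)"
  define R' where "R' = (\<lambda>\<theta>. R \<theta> * ?a \<theta> / ?w \<theta>)"
  have dR: "(R has_real_derivative R' \<theta>) (at \<theta>)" for \<theta>
    unfolding R'_def z_def[abs_def] by (rule level_curve_deriv) (use R level in auto)
  have z_nz: "z \<theta> \<noteq> 0" for \<theta> using R[of \<theta>] by (simp add: z_def)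
  have w_pos: "?w \<theta> > 0" for \<theta>
    by (rule rotation) (use z_nz R[of \<theta>] in \<open>auto simp: z_def norm_mult\<close>)
  have dz: "(z has_vector_derivative (of_real (R' \<theta>) + \<i> * of_real (R \<theta>)) * cis \<theta>) (at \<theta>)" for \<theta>
    unfolding z_def[abs_def] has_vector_derivative_def
    by (rule derivative_eq_intros dR[unfolded has_field_derivative_def] refl)+
      (simp add: scaleR_conv_of_real algebra_simps)
  have cont_z: "continuous_on UNIV z"
    using dz by (auto intro!: continuous_at_imp_continuous_on has_vector_derivative_continuous)
  have "continuous_on UNIV ?w"
    using z_nz by (intro continuous_intros continuous_on_compose2[OF X_cont cont_z] cont_z) auto
  moreover have R_per: "R (\<theta> + 2 * pi) = R \<theta>" for \<theta>
  proof (rule H_radial_inj[of _ _ \<theta>])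
    have "cis \<theta> = cis (\<theta> + 2 * pi)" by (simp flip: cis_mult)
    then show "H (of_real (R (\<theta> + 2 * pi)) * cis \<theta>) = H (of_real (R \<theta>) * cis \<theta>)"
      using level[of "\<theta> + 2 * pi"] level[of \<theta>] by simp
  qed (use R less_imp_le in auto)
  moreover have "?w (\<theta> + 2 * pi) = ?w \<theta>" for \<theta>
    by (simp add: z_def R_per flip: cis_mult)
  moreover have "X (z \<theta>) = ?w \<theta> *\<^sub>R ((of_real (R' \<theta>) + \<i> * of_real (R \<theta>)) * cis \<theta>)" for \<theta>
  proof -
    have "of_real (?w \<theta>) * (of_real (R' \<theta>) + \<i> * of_real (R \<theta>))
        = of_real (R \<theta>) * (of_real (?a \<theta>) + \<i> * of_real (?w \<theta>))"
      using w_pos[of \<theta>] by (simp add: R'_def complex_eq_iff)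
    also have "\<dots> = of_real (R \<theta>) * (X (z \<theta>) / z \<theta>)"
      by (simp flip: complex_eq)
    finally have "?w \<theta> *\<^sub>R ((of_real (R' \<theta>) + \<i> * of_real (R \<theta>)) * cis \<theta>)
        = of_real (R \<theta>) * (X (z \<theta>) / z \<theta>) * cis \<theta>"
      by (simp only: scaleR_conv_of_real flip: mult.assoc)
    also have "\<dots> = X (z \<theta>)" using R[of \<theta>] by (simp add: z_def)
    finally show ?thesis ..
  qed
  ultimately show ?thesis
    using periodic_orbit_of_closed_polar_curve[where w = ?w, OF z_def R(1) dz _ w_pos] by blast
qed

text \<open>
  On the circle of radius \<open>\<eta>\<close> the Hamiltonian stays above \<open>H 0\<close> by a fixed margin, by compactness.
  Every ray therefore meets each level within that margin before it leaves the disc.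
\<close>

lemma level_curves_exist:
  assumes "0 < \<eta>" "\<eta> < \<delta>"
  shows "\<exists>\<mu>>0. \<forall>E. H 0 < E \<and> E < H 0 + \<mu> \<longrightarrow>
           (\<exists>R. \<forall>\<theta>. 0 < R \<theta> \<and> R \<theta> < \<eta> \<and> H (of_real (R \<theta>) * cis \<theta>) = E)"
proof -
  have cont_H: "continuous_on A H" for A
    using H_deriv by (auto intro!: continuous_at_imp_continuous_on has_derivative_continuous)
  have "compact (sphere (0::complex) \<eta>)" "sphere (0::complex) \<eta> \<noteq> {}"
    using assms by auto
  from continuous_attains_inf[OF this cont_H] obtain z0 where z0: "z0 \<in> sphere 0 \<eta>"
    and min: "\<And>z. z \<in> sphere 0 \<eta> \<Longrightarrow> H z0 \<le> H z" by blast
  have "H (of_real 0 * cis (Arg z0)) < H (of_real \<eta> * cis (Arg z0))"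
    using assms by (intro H_radial_strict_mono) auto
  moreover have "of_real \<eta> * cis (Arg z0) = z0"
    using z0 rcis_cmod_Arg[of z0] by (simp add: rcis_def)
  ultimately have pos: "H z0 - H 0 > 0" by simp
  have "\<exists>\<rho>. 0 < \<rho> \<and> \<rho> < \<eta> \<and> H (of_real \<rho> * cis \<theta>) = E"
    if E: "H 0 < E" "E < H 0 + (H z0 - H 0)" for E \<theta>
  proof -
    have le: "H z0 \<le> H (of_real \<eta> * cis \<theta>)"
      using assms by (intro min) (simp add: norm_mult)
    have "continuous_on {0..\<eta>} (\<lambda>\<rho>. H (of_real \<rho> * cis \<theta>))"
      using H_radial_deriv DERIV_isCont by (metis continuous_at_imp_continuous_on)
    from IVT'[OF _ _ _ this, of E] obtain \<rho>
      where \<rho>: "0 \<le> \<rho>" "\<rho> \<le> \<eta>" "H (of_real \<rho> * cis \<theta>) = E"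
      using E le assms by auto
    then have "\<rho> \<noteq> 0" "\<rho> \<noteq> \<eta>" using E le by auto
    with \<rho> show ?thesis by (intro exI[of _ \<rho>]) auto
  qed
  then show ?thesis using pos by (intro exI[of _ "H z0 - H 0"]) metis
qed

lemma center: "center_at_origin X"
  unfolding center_at_origin_def
proof (intro conjI X_0)
  have cont_H: "continuous_on A H" for A
    using H_deriv by (auto intro!: continuous_at_imp_continuous_on has_derivative_continuous)
  define \<eta> where "\<eta> = \<delta> / 2"
  have \<eta>: "0 < \<eta>" "\<eta> < \<delta>" using \<delta>_pos by (auto simp: \<eta>_def)
  obtain \<mu> where \<mu>: "\<mu> > 0" and ex: "\<And>E. \<lbrakk>H 0 < E; E < H 0 + \<mu>\<rbrakk> \<Longrightarrow>
           \<exists>R. \<forall>\<theta>. 0 < R \<theta> \<and> R \<theta> < \<eta> \<and> H (of_real (R \<theta>) * cis \<theta>) = E"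
    using level_curves_exist[OF \<eta>] by blast
  \<comment> \<open>Bounding \<open>H\<close> as well as the norm makes \<open>U\<close> invariant under the flow.\<close>
  define U where "U = {z. norm z < \<eta>} \<inter> {z. H z < H 0 + \<mu>}"
  have "open U" unfolding U_def
    by (intro open_Int open_Collect_less continuous_intros cont_H)
  moreover have "0 \<in> U" using \<eta> \<mu> by (simp add: U_def)
  moreover have "\<exists>\<gamma> T. periodic_orbit X \<gamma> T \<and> z \<in> range \<gamma> \<and> range \<gamma> \<subseteq> U"
    if z: "z \<in> U - {0}" for z
  proof -
    have z_eq: "z = of_real (norm z) * cis (Arg z)"
      using rcis_cmod_Arg[of z] by (simp add: rcis_def)
    have "H (of_real 0 * cis (Arg z)) < H (of_real (norm z) * cis (Arg z))"
      using z \<eta> by (intro H_radial_strict_mono) (auto simp: U_def)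
    then have "H 0 < H z" using z_eq by simp
    moreover have lt: "H z < H 0 + \<mu>" using z by (simp add: U_def)
    ultimately obtain R where R: "\<And>\<theta>. 0 < R \<theta>" "\<And>\<theta>. R \<theta> < \<eta>"
      and level: "\<And>\<theta>. H (of_real (R \<theta>) * cis \<theta>) = H z"
      using ex by metis
    have R_lt: "R \<theta> < \<delta>" for \<theta> using R(2)[of \<theta>] \<eta> by simp
    from level_curve_orbit[of R "H z", OF R(1) R_lt level refl] obtain \<gamma> T where
      orbit: "periodic_orbit X \<gamma> T" and range: "range \<gamma> = range (\<lambda>\<theta>. of_real (R \<theta>) * cis \<theta>)"
      by blast
    have "R (Arg z) = norm z"
      by (rule H_radial_inj[of _ _ "Arg z"])
        (use R(1)[of "Arg z"] R_lt z \<eta> level z_eq[symmetric] in \<open>auto simp: U_def\<close>)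
    then have "z = of_real (R (Arg z)) * cis (Arg z)" using z_eq by simp
    then have "z \<in> range \<gamma>" unfolding range by blast
    moreover have "range \<gamma> \<subseteq> U"
      unfolding range using R lt level by (auto simp: U_def norm_mult less_imp_le abs_of_pos)
    ultimately show ?thesis using orbit by blast
  qed
  ultimately show "\<exists>U. open U \<and> 0 \<in> U \<and>
      (\<forall>z\<in>U - {0}. \<exists>\<gamma> T. periodic_orbit X \<gamma> T \<and> z \<in> range \<gamma> \<and> range \<gamma> \<subseteq> U)"
    by blast
qed

text \<open>
  The level curves are parametrised by \<open>e = sqrt (2 (E - H 0))\<close>, which is the radius of the
  corresponding circle of the linear center; all later expansions are in powers of \<open>e\<close>.
\<close>

lemma isochronous_imp_constant_period_integral:
  assumes "isochronous X"
  obtains T R \<mu> where "\<mu> > 0"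
    and "\<And>e \<theta>. \<lbrakk>0 < e; e < \<mu>\<rbrakk> \<Longrightarrow>
      0 < R e \<theta> \<and> R e \<theta> < \<delta> \<and> H (of_real (R e \<theta>) * cis \<theta>) = H 0 + e\<^sup>2 / 2"
    and "\<And>e. \<lbrakk>0 < e; e < \<mu>\<rbrakk> \<Longrightarrow> ((\<lambda>\<theta>. 1 / Im (X (of_real (R e \<theta>) * cis \<theta>) /
      (of_real (R e \<theta>) * cis \<theta>))) has_integral T) {0..2*pi}"
proof -
  obtain U T where U: "open U" "0 \<in> U"
    and T: "\<And>\<gamma> S. \<lbrakk>periodic_orbit X \<gamma> S; range \<gamma> \<subseteq> U\<rbrakk> \<Longrightarrow> S = T"
    using assms unfolding isochronous_def by blast
  obtain \<epsilon> where \<epsilon>: "\<epsilon> > 0" "ball 0 \<epsilon> \<subseteq> U" using U openE by blast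
  define \<eta> where "\<eta> = min \<epsilon> (\<delta> / 2)"
  have \<eta>: "0 < \<eta>" "\<eta> < \<delta>" using \<delta>_pos \<epsilon> by (auto simp: \<eta>_def)
  obtain \<mu> where \<mu>: "\<mu> > 0" and ex: "\<And>E. \<lbrakk>H 0 < E; E < H 0 + \<mu>\<rbrakk> \<Longrightarrow>
           \<exists>R. \<forall>\<theta>. 0 < R \<theta> \<and> R \<theta> < \<eta> \<and> H (of_real (R \<theta>) * cis \<theta>) = E"
    using level_curves_exist[OF \<eta>] by blast
  have "\<exists>R. \<forall>\<theta>. 0 < R \<theta> \<and> R \<theta> < \<eta> \<and> H (of_real (R \<theta>) * cis \<theta>) = H 0 + e\<^sup>2 / 2"
    if "e \<in> {0<..<sqrt (2 * \<mu>)}" for e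
  proof (rule ex)
    have "e\<^sup>2 < (sqrt (2 * \<mu>))\<^sup>2" using that by (intro power_strict_mono) auto
    then show "H 0 + e\<^sup>2 / 2 < H 0 + \<mu>" using \<mu> by simp
  qed (use that in auto)
  then obtain R where R: "\<And>e \<theta>. e \<in> {0<..<sqrt (2 * \<mu>)} \<Longrightarrow>
      0 < R e \<theta> \<and> R e \<theta> < \<eta> \<and> H (of_real (R e \<theta>) * cis \<theta>) = H 0 + e\<^sup>2 / 2"
    by metis
  have period: "((\<lambda>\<theta>. 1 / Im (X (of_real (R e \<theta>) * cis \<theta>) / (of_real (R e \<theta>) * cis \<theta>))) has_integral T) {0..2*pi}"
    if e: "e \<in> {0<..<sqrt (2 * \<mu>)}" for e
  proof -
    have "R e \<theta> < \<delta>" for \<theta> using R[OF e, of \<theta>] \<eta> by simp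
    from level_curve_orbit[of "R e", OF _ this _ refl] R[OF e] obtain \<gamma> S where
      orbit: "periodic_orbit X \<gamma> S" and S: "((\<lambda>\<theta>. 1 / Im (X (of_real (R e \<theta>) * cis \<theta>) /
        (of_real (R e \<theta>) * cis \<theta>))) has_integral S) {0..2*pi}"
      and range: "range \<gamma> = range (\<lambda>\<theta>. of_real (R e \<theta>) * cis \<theta>)"
      by blast
    have "\<bar>R e \<theta>\<bar> < \<epsilon>" for \<theta> using R[OF e, of \<theta>] by (simp add: \<eta>_def)
    then have "range \<gamma> \<subseteq> U"
      unfolding range using \<epsilon>(2) by (auto simp: norm_mult)
    with orbit have "S = T" by (rule T)
    with S show ?thesis by simp
  qed
  show thesis
  proof (rule that[of "sqrt (2 * \<mu>)" R T])
    show "0 < R e \<theta> \<and> R e \<theta> < \<delta> \<and> H (of_real (R e \<theta>) * cis \<theta>) = H 0 + e\<^sup>2 / 2"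
      if "0 < e" "e < sqrt (2 * \<mu>)" for e \<theta>
      using R[of e \<theta>] that \<eta>(2) by simp
  qed (use \<mu> period in auto)
qed

end

section \<open>Second-order expansion of the period\<close>

lemma bigo_power_mono:
  fixes e :: "'a \<Rightarrow> real"
  assumes "(e \<longlongrightarrow> 0) F" "b \<le> a"
  shows "(\<lambda>x. e x ^ a) \<in> O[F](\<lambda>x. e x ^ b)"
proof -
  have "((\<lambda>x. e x ^ (a - b)) \<longlongrightarrow> 0 ^ (a - b)) F"
    by (intro tendsto_intros assms)
  then have "(\<lambda>x. e x ^ (a - b)) \<in> O[F](\<lambda>_. 1)"
    by (intro bigoI_tendsto) auto
  from landau_o.big.mult[OF this landau_o.big_refl[of "\<lambda>x. e x ^ b"]] show ?thesis
    using assms(2) by (simp flip: power_add)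
qed

text \<open>
  With \<open>D = (\<Sum>s. R^s g\<^sub>s)\<close> the level equation gives \<open>R = e - e^(q+1) g\<^sub>q/(q+2) + O(e^(q+2))\<close>. Inserted
  into \<open>D\<close>, the correction matters at order \<open>e^(2 q)\<close> only through the term \<open>s = q\<close>, which contributes
  \<open>-q/(q+2) e^(2 q) g\<^sub>q\<^sup>2\<close>. Together with \<open>D\<^sup>2\<close> from \<open>1/(1+D) = 1 - D + D\<^sup>2 - ...\<close> this gives the factor
  \<open>1 + q/(q+2) = (2 q + 2)/(q+2)\<close>. The filter is arbitrary so that a product with a principal filter
  yields bounds that are uniform in the angle.
\<close>

lemma angular_slowness_expansion:
  fixes e R :: "'a \<Rightarrow> real" and g :: "nat \<Rightarrow> 'a \<Rightarrow> real"
  assumes q: "1 \<le> q" "q \<le> M"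
    and e_0: "(e \<longlongrightarrow> 0) F" and e_pos: "\<forall>\<^sub>F x in F. 0 < e x"
    and R_0: "(R \<longlongrightarrow> 0) F" and R_pos: "\<forall>\<^sub>F x in F. 0 < R x"
    and g_bdd: "\<And>s. g s \<in> O[F](\<lambda>_. 1)"
    and level: "\<forall>\<^sub>F x in F. (R x)\<^sup>2 / 2 + (\<Sum>s=q..M. R x ^ (s + 2) * g s x / real (s + 2)) = (e x)\<^sup>2 / 2"
  shows "(\<lambda>x. 1 / (1 + (\<Sum>s=q..M. R x ^ s * g s x)) - 1 + (\<Sum>s=q..M. e x ^ s * g s x)
           - real (2 * q + 2) / real (q + 2) * (e x ^ (2 * q) * (g q x)\<^sup>2)) \<in> O[F](\<lambda>x. e x ^ (2 * q + 1))"
proof -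
  define S where "S = (\<lambda>x. \<Sum>s=q..M. R x ^ (s + 2) * g s x / real (s + 2))"
  define D where "D = (\<lambda>x. \<Sum>s=q..M. R x ^ s * g s x)"
  have lower: "f \<in> O[F](\<lambda>x. e x ^ b)" if "f \<in> O[F](\<lambda>x. e x ^ a)" "b \<le> a" for f a b
    using landau_o.big_trans[OF that(1) bigo_power_mono[OF e_0 that(2)]] .
  have mult: "(\<lambda>x. f x * h x) \<in> O[F](\<lambda>x. e x ^ c)"
    if "f \<in> O[F](\<lambda>x. e x ^ a)" "h \<in> O[F](\<lambda>x. e x ^ b)" "c \<le> a + b" for f h a b c
    using lower[OF landau_o.big.mult[OF that(1,2), folded power_add] that(3)] .
  have g_mult: "(\<lambda>x. f x * g s x) \<in> O[F](\<lambda>x. e x ^ a)" if "f \<in> O[F](\<lambda>x. e x ^ a)" for f a s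
    using mult[OF that, of "g s" 0 a] g_bdd by simp
  have const: "(\<lambda>x. c * f x) \<in> O[F](\<lambda>x. e x ^ a)" if "f \<in> O[F](\<lambda>x. e x ^ a)" for c f a
    using that by simp
  have e_pow: "(\<lambda>x. e x ^ a) \<in> O[F](\<lambda>x. e x ^ b)" if "b \<le> a" for a b
    by (rule bigo_power_mono[OF e_0 that])
  \<comment> \<open>Division of an estimate by \<open>e\<close>, in a form that allows \<open>f e\<close> to be merely dominated.\<close>
  have cancel: "f \<in> O[F](\<lambda>x. e x ^ a)"
    if "h \<in> O[F](\<lambda>x. e x ^ Suc a)" and le: "\<forall>\<^sub>F x in F. \<bar>f x * e x\<bar> \<le> \<bar>h x\<bar>" for f h a
  proof -
    obtain C where "\<forall>\<^sub>F x in F. norm (h x) \<le> C * norm (e x ^ Suc a)"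
      using \<open>h \<in> _\<close> by (elim landau_o.bigE)
    with le e_pos have "\<forall>\<^sub>F x in F. norm (f x) \<le> C * norm (e x ^ a)"
    proof eventually_elim
      case (elim x)
      then have "\<bar>f x * e x\<bar> \<le> C * norm (e x ^ Suc a)" by simp
      with elim(2) have "e x * norm (f x) \<le> e x * (C * norm (e x ^ a))"
        by (simp add: abs_mult mult_ac)
      with elim(2) show ?case by simp
    qed
    then show ?thesis by (rule bigoI)
  qed

  \<comment> \<open>The higher terms of the level equation are at most half of its leading term, so \<open>R \<le> 2 e\<close>.\<close>
  have R_e: "R \<in> O[F](\<lambda>x. e x)"
  proof -
    have "S \<in> O[F](\<lambda>x. R x ^ 3)"
      unfolding S_def
    proof (rule big_sum_in_bigo)
      fix s assume "s \<in> {q..M}"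
      then have "(\<lambda>x. R x ^ (s + 2)) \<in> O[F](\<lambda>x. R x ^ 3)"
        using q by (intro bigo_power_mono[OF R_0]) auto
      from landau_o.big.mult[OF this g_bdd[of s]]
      show "(\<lambda>x. R x ^ (s + 2) * g s x / real (s + 2)) \<in> O[F](\<lambda>x. R x ^ 3)" by simp
    qed
    then obtain C where C: "C > 0" "\<forall>\<^sub>F x in F. norm (S x) \<le> C * norm (R x ^ 3)"
      by (elim landau_o.bigE)
    have "\<forall>\<^sub>F x in F. R x < 1 / (4 * C)"
      using order_tendstoD(2)[OF R_0, of "1 / (4 * C)"] C by simp
    with C(2) R_pos e_pos level have "\<forall>\<^sub>F x in F. norm (R x) \<le> 2 * norm (e x)"
    proof eventually_elim
      case (elim x)
      have "\<bar>S x\<bar> \<le> C * R x * (R x)\<^sup>2"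
        using elim by (simp add: power2_eq_square power3_eq_cube mult_ac)
      also have "\<dots> \<le> 1 / 4 * (R x)\<^sup>2"
        using elim(5) C by (intro mult_right_mono) (auto simp: field_simps)
      finally have "\<bar>S x\<bar> \<le> (R x)\<^sup>2 / 4" by simp
      with elim(4) have "(R x)\<^sup>2 \<le> 2 * (e x)\<^sup>2" by (simp add: S_def)
      also have "\<dots> \<le> (2 * e x)\<^sup>2" by (simp add: power_mult_distrib)
      finally have "R x \<le> 2 * e x" by (rule power2_le_imp_le) (use elim(3) in simp)
      with elim(2,3) show ?case by simp
    qed
    then show ?thesis by (rule bigoI)
  qed
  have R_pow: "(\<lambda>x. R x ^ a) \<in> O[F](\<lambda>x. e x ^ b)" if "b \<le> a" for a b
    using lower[OF landau_o.big_power[OF R_e] that] .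

  have diff_sq: "\<forall>\<^sub>F x in F. (R x - e x) * (R x + e x) = - 2 * S x"
    using level by eventually_elim (simp add: S_def power2_eq_square algebra_simps)
  have "S \<in> O[F](\<lambda>x. e x ^ (q + 2))"
    unfolding S_def
  proof (rule big_sum_in_bigo)
    fix s assume "s \<in> {q..M}"
    then have "(\<lambda>x. R x ^ (s + 2) * g s x) \<in> O[F](\<lambda>x. e x ^ (q + 2))"
      by (intro g_mult R_pow) auto
    then show "(\<lambda>x. R x ^ (s + 2) * g s x / real (s + 2)) \<in> O[F](\<lambda>x. e x ^ (q + 2))" by simp
  qed
  then have "(\<lambda>x. 2 * S x) \<in> O[F](\<lambda>x. e x ^ Suc (q + 1))" by simp
  then have diff: "(\<lambda>x. R x - e x) \<in> O[F](\<lambda>x. e x ^ (q + 1))"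
  proof (rule cancel)
    show "\<forall>\<^sub>F x in F. \<bar>(R x - e x) * e x\<bar> \<le> \<bar>2 * S x\<bar>"
      using diff_sq e_pos R_pos
    proof eventually_elim
      case (elim x)
      have "\<bar>(R x - e x) * e x\<bar> \<le> \<bar>(R x - e x) * (R x + e x)\<bar>"
        using elim(2,3) unfolding abs_mult by (intro mult_left_mono) auto
      with elim(1) show ?case by simp
    qed
  qed
  have diff_pow: "(\<lambda>x. R x ^ m - e x ^ m) \<in> O[F](\<lambda>x. e x ^ (q + m))" for m
  proof (induction m)
    case (Suc m)
    have "(\<lambda>x. R x ^ m * (R x - e x) + e x ^ 1 * (R x ^ m - e x ^ m)) \<in> O[F](\<lambda>x. e x ^ (q + Suc m))"
      by (intro sum_in_bigo mult[OF R_pow[OF order_refl] diff] mult[OF e_pow[OF order_refl] Suc]) auto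
    then show ?case by (simp add: algebra_simps)
  qed simp
  \<comment> \<open>First-order Taylor expansion of the power; at \<open>m = 0\<close> the truncated exponent is harmless, as its factor is 0.\<close>
  have taylor: "(\<lambda>x. R x ^ m - e x ^ m - real m * e x ^ (m - 1) * (R x - e x)) \<in> O[F](\<lambda>x. e x ^ (2 * q + m))" for m
  proof (induction m)
    case (Suc m)
    have "(\<lambda>x. (R x ^ m - e x ^ m) * (R x - e x) +
        e x ^ 1 * (R x ^ m - e x ^ m - real m * e x ^ (m - 1) * (R x - e x))) \<in> O[F](\<lambda>x. e x ^ (2 * q + Suc m))"
      by (intro sum_in_bigo mult[OF diff_pow diff] mult[OF e_pow[OF order_refl] Suc]) auto
    then show ?case by (cases m) (simp_all add: algebra_simps)
  qed simp

  have split: "(\<Sum>s=q..M. h s) = h q + (\<Sum>s=Suc q..M. h s)" for h :: "nat \<Rightarrow> real"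
    using q by (simp add: sum.atLeast_Suc_atMost)
  \<comment> \<open>From \<open>2 e (R - e) = - 2 S - (R - e)\<^sup>2\<close>, where only the term \<open>s = q\<close> of \<open>S\<close> has order \<open>e^(q+2)\<close>.\<close>
  have R_first: "(\<lambda>x. R x - e x + e x ^ (q + 1) * g q x / real (q + 2)) \<in> O[F](\<lambda>x. e x ^ (q + 2))"
  proof (rule cancel)
    have "(\<lambda>x. (R x ^ (q + 2) - e x ^ (q + 2)) * g q x / real (q + 2)
        + (\<Sum>s=Suc q..M. R x ^ (s + 2) * g s x / real (s + 2))) \<in> O[F](\<lambda>x. e x ^ (q + 3))"
    proof (intro sum_in_bigo big_sum_in_bigo)
      have "(\<lambda>x. (R x ^ (q + 2) - e x ^ (q + 2)) * g q x) \<in> O[F](\<lambda>x. e x ^ (q + 3))"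
        by (intro g_mult lower[OF diff_pow]) (use q in auto)
      then show "(\<lambda>x. (R x ^ (q + 2) - e x ^ (q + 2)) * g q x / real (q + 2)) \<in> O[F](\<lambda>x. e x ^ (q + 3))"
        by simp
    next
      fix s assume "s \<in> {Suc q..M}"
      then have "(\<lambda>x. R x ^ (s + 2) * g s x) \<in> O[F](\<lambda>x. e x ^ (q + 3))"
        by (intro g_mult R_pow) auto
      then show "(\<lambda>x. R x ^ (s + 2) * g s x / real (s + 2)) \<in> O[F](\<lambda>x. e x ^ (q + 3))" by simp
    qed
    then have "(\<lambda>x. S x - e x ^ (q + 2) * g q x / real (q + 2)) \<in> O[F](\<lambda>x. e x ^ (q + 3))"
      unfolding S_def split by (simp add: algebra_simps diff_divide_distrib)
    moreover have "(\<lambda>x. (R x - e x) * (R x - e x)) \<in> O[F](\<lambda>x. e x ^ (q + 3))"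
      by (rule mult[OF diff diff]) (use q in auto)
    ultimately have "(\<lambda>x. (S x - e x ^ (q + 2) * g q x / real (q + 2)) + 1 / 2 * ((R x - e x) * (R x - e x)))
        \<in> O[F](\<lambda>x. e x ^ (q + 3))"
      by (rule sum_in_bigo(1)[OF _ const])
    then show "(\<lambda>x. (S x - e x ^ (q + 2) * g q x / real (q + 2)) + 1 / 2 * ((R x - e x) * (R x - e x)))
        \<in> O[F](\<lambda>x. e x ^ Suc (q + 2))" by (simp add: eval_nat_numeral)
    show "\<forall>\<^sub>F x in F. \<bar>(R x - e x + e x ^ (q + 1) * g q x / real (q + 2)) * e x\<bar>
        \<le> \<bar>(S x - e x ^ (q + 2) * g q x / real (q + 2)) + 1 / 2 * ((R x - e x) * (R x - e x))\<bar>"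
      using diff_sq
    proof eventually_elim
      case (elim x)
      have "(R x - e x + e x ^ (q + 1) * g q x / real (q + 2)) * e x
        = - ((S x - e x ^ (q + 2) * g q x / real (q + 2)) + 1 / 2 * ((R x - e x) * (R x - e x)))"
        using elim by (simp add: algebra_simps)
      then show ?case by (simp only: abs_minus_cancel)
    qed
  qed

  have D_second: "(\<lambda>x. D x - (\<Sum>s=q..M. e x ^ s * g s x) + real q / real (q + 2) * (e x ^ (2 * q) * (g q x)\<^sup>2))
      \<in> O[F](\<lambda>x. e x ^ (2 * q + 1))"
  proof -
    have "(\<lambda>x. ((R x ^ q - e x ^ q - real q * e x ^ (q - 1) * (R x - e x))
          + real q * (e x ^ (q - 1) * (R x - e x + e x ^ (q + 1) * g q x / real (q + 2)))) * g q x
        + (\<Sum>s=Suc q..M. (R x ^ s - e x ^ s) * g s x)) \<in> O[F](\<lambda>x. e x ^ (2 * q + 1))"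
      by (rule sum_in_bigo(1)[OF g_mult[OF sum_in_bigo(1)[OF lower[OF taylor]
              const[OF mult[OF e_pow[OF order_refl] R_first]]]]
            big_sum_in_bigo[OF g_mult[OF lower[OF diff_pow]]]]) (use q in auto)
    moreover have "((R x ^ q - e x ^ q - real q * e x ^ (q - 1) * (R x - e x))
          + real q * (e x ^ (q - 1) * (R x - e x + e x ^ (q + 1) * g q x / real (q + 2)))) * g q x
        + (\<Sum>s=Suc q..M. (R x ^ s - e x ^ s) * g s x)
      = D x - (\<Sum>s=q..M. e x ^ s * g s x) + real q / real (q + 2) * (e x ^ (2 * q) * (g q x)\<^sup>2)" for x
    proof -
      have e: "e x ^ (2 * q) = e x ^ (q - 1) * e x ^ (q + 1)"
        using q by (cases q) (simp_all add: mult_2 power_add)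
      show ?thesis
        unfolding D_def split e sum_subtractf left_diff_distrib
        by (simp add: algebra_simps power2_eq_square)
    qed
    ultimately show ?thesis by simp
  qed
  have D_first: "(\<lambda>x. D x - e x ^ q * g q x) \<in> O[F](\<lambda>x. e x ^ (q + 1))"
  proof -
    have "(\<lambda>x. (R x ^ q - e x ^ q) * g q x + (\<Sum>s=Suc q..M. R x ^ s * g s x)) \<in> O[F](\<lambda>x. e x ^ (q + 1))"
      by (rule sum_in_bigo(1)[OF g_mult[OF lower[OF diff_pow]] big_sum_in_bigo[OF g_mult[OF R_pow]]])
        (use q in auto)
    then show ?thesis unfolding D_def split by (simp add: algebra_simps)
  qed
  have D_big: "D \<in> O[F](\<lambda>x. e x ^ q)"
    unfolding D_def by (intro big_sum_in_bigo g_mult R_pow) auto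
  have "(\<lambda>x. D x + e x ^ q * g q x) \<in> O[F](\<lambda>x. e x ^ q)"
    by (intro sum_in_bigo D_big g_mult e_pow) auto
  from mult[OF D_first this, of "2 * q + 1"]
  have "(\<lambda>x. (D x - e x ^ q * g q x) * (D x + e x ^ q * g q x)) \<in> O[F](\<lambda>x. e x ^ (2 * q + 1))"
    by simp
  moreover have "(D x - e x ^ q * g q x) * (D x + e x ^ q * g q x) = (D x)\<^sup>2 - e x ^ (2 * q) * (g q x)\<^sup>2" for x
    unfolding power_even_eq by (simp add: algebra_simps power2_eq_square)
  ultimately have D_sq: "(\<lambda>x. (D x)\<^sup>2 - e x ^ (2 * q) * (g q x)\<^sup>2) \<in> O[F](\<lambda>x. e x ^ (2 * q + 1))"
    by simp
  have D_0: "(D \<longlongrightarrow> 0) F"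
  proof -
    have "((\<lambda>x. e x ^ q) \<longlongrightarrow> 0 ^ q) F" by (intro tendsto_intros e_0)
    then have "((\<lambda>x. e x ^ q) \<longlongrightarrow> 0) F" using q by (simp add: power_0_left)
    then have "(\<lambda>x. e x ^ q) \<in> o[F](\<lambda>_. 1)" by (intro smalloI_tendsto) auto
    from landau_o.big_small_trans[OF D_big this] show ?thesis by (auto dest: smalloD_tendsto)
  qed
  have geometric: "(\<lambda>x. 1 / (1 + D x) - 1 + D x - (D x)\<^sup>2) \<in> O[F](\<lambda>x. e x ^ (2 * q + 1))"
  proof -
    have "\<forall>\<^sub>F x in F. norm (1 / (1 + D x) - 1 + D x - (D x)\<^sup>2) \<le> 2 * norm (D x * (D x * D x))"
      using order_tendstoD(1)[OF D_0, of "- 1 / 2", simplified]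
    proof eventually_elim
      case (elim x)
      have "1 / (1 + D x) - 1 + D x - (D x)\<^sup>2 = - (1 / (1 + D x)) * (D x * (D x * D x))"
        using elim by (simp add: field_simps power2_eq_square)
      moreover have "norm (- (1 / (1 + D x))) \<le> 2" using elim by (simp add: field_simps)
      ultimately show ?case by (metis mult_right_mono norm_ge_zero norm_mult)
    qed
    then have "(\<lambda>x. 1 / (1 + D x) - 1 + D x - (D x)\<^sup>2) \<in> O[F](\<lambda>x. D x * (D x * D x))" by (rule bigoI)
    also have "(\<lambda>x. D x * (D x * D x)) \<in> O[F](\<lambda>x. e x ^ (2 * q + 1))"
      using q by (intro mult[OF D_big mult[OF D_big D_big order_refl]]) auto
    finally show ?thesis .
  qed
  have "real (2 * q + 2) / real (q + 2) = 1 + real q / real (q + 2)"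
    by (simp add: field_simps)
  then have "1 / (1 + D x) - 1 + (\<Sum>s=q..M. e x ^ s * g s x)
         - real (2 * q + 2) / real (q + 2) * (e x ^ (2 * q) * (g q x)\<^sup>2)
      = (1 / (1 + D x) - 1 + D x - (D x)\<^sup>2)
        - (D x - (\<Sum>s=q..M. e x ^ s * g s x) + real q / real (q + 2) * (e x ^ (2 * q) * (g q x)\<^sup>2))
        + ((D x)\<^sup>2 - e x ^ (2 * q) * (g q x)\<^sup>2)" for x
    by (simp only: distrib_right)
  moreover have "(\<lambda>x. (1 / (1 + D x) - 1 + D x - (D x)\<^sup>2)
        - (D x - (\<Sum>s=q..M. e x ^ s * g s x) + real q / real (q + 2) * (e x ^ (2 * q) * (g q x)\<^sup>2))
        + ((D x)\<^sup>2 - e x ^ (2 * q) * (g q x)\<^sup>2)) \<in> O[F](\<lambda>x. e x ^ (2 * q + 1))"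
    by (rule sum_in_bigo(1)[OF sum_in_bigo(2)[OF geometric D_second] D_sq])
  ultimately show ?thesis by (simp only: D_def)
qed

text \<open>
  The constant coefficient is the limit at 0, so it vanishes; dividing by the variable lowers both
  the degree and the order of vanishing by one.
\<close>

lemma poly_eq_0_if_small_at_0:
  fixes q :: "real poly"
  assumes "(\<lambda>e. poly q e) \<in> O[at_right 0](\<lambda>e. e ^ N)" "degree q < N"
  shows "q = 0"
  using assms
proof (induction N arbitrary: q)
  case 0
  from 0(2) show ?case by simp
next
  case (Suc N)
  have lim: "(poly q \<longlongrightarrow> poly q 0) (at_right 0)"
    by (intro tendsto_intros)
  have "((\<lambda>e::real. e ^ Suc N) \<longlongrightarrow> 0 ^ Suc N) (at_right 0)"
    by (intro tendsto_intros)
  then have "(\<lambda>e::real. e ^ Suc N) \<in> o[at_right 0](\<lambda>_. 1)"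
    by (intro smalloI_tendsto) auto
  from landau_o.big_small_trans[OF Suc.prems(1) this]
  have "(poly q \<longlongrightarrow> 0) (at_right 0)" by (auto dest: smalloD_tendsto)
  with lim have "poly q 0 = 0" by (intro tendsto_unique[of "at_right 0"]) auto
  then obtain p where q: "q = [:0, 1:] * p"
    by (auto simp: poly_eq_0_iff_dvd elim: dvdE)
  show ?case
  proof (cases "p = 0")
    case False
    obtain C where "\<forall>\<^sub>F e in at_right 0. norm (poly q e) \<le> C * norm (e ^ Suc N)"
      using Suc.prems(1) by (elim landau_o.bigE)
    with eventually_at_right_less[of 0]
    have "\<forall>\<^sub>F e in at_right 0. norm (poly p e) \<le> C * norm (e ^ N)"
    proof eventually_elim
      case (elim e)
      then have "e * norm (poly p e) \<le> e * (C * norm (e ^ N))"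
        by (simp add: q abs_mult mult_ac)
      with elim(1) show ?case by simp
    qed
    then have "(\<lambda>e. poly p e) \<in> O[at_right 0](\<lambda>e. e ^ N)" by (rule bigoI)
    moreover have "degree p < N"
      using Suc.prems(2) False by (simp add: q degree_mult_eq)
    ultimately show ?thesis using Suc.IH q by simp
  qed (simp add: q)
qed

text \<open>
  A period \<open>T\<close> common to all small levels turns the integrated expansion into an identity between a
  polynomial in \<open>e\<close> of degree at most \<open>2 q\<close> and an error of order \<open>e^(2 q + 1)\<close>. The hypothesis
  \<open>M < 2 q\<close> keeps the linear terms away from the coefficient at \<open>e^(2 q)\<close>.
\<close>

lemma constant_period_imp_square_integral_zero:
  fixes a :: "nat \<Rightarrow> real \<Rightarrow> real" and R :: "real \<Rightarrow> real \<Rightarrow> real"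
  assumes q: "1 \<le> q" "q \<le> M" "M < 2 * q" and "0 < \<mu>"
    and a_cont: "\<And>s. continuous_on UNIV (a s)" and a_bdd: "\<And>s \<theta>. \<bar>a s \<theta>\<bar> \<le> B s"
    and R: "\<And>e \<theta>. \<lbrakk>0 < e; e < \<mu>\<rbrakk> \<Longrightarrow> 0 < R e \<theta> \<and> R e \<theta> \<le> 2 * e"
    and level: "\<And>e \<theta>. \<lbrakk>0 < e; e < \<mu>\<rbrakk> \<Longrightarrow>
      (R e \<theta>)\<^sup>2 / 2 + (\<Sum>s=q..M. R e \<theta> ^ (s + 2) * a s \<theta> / real (s + 2)) = e\<^sup>2 / 2"
    and period: "\<And>e. \<lbrakk>0 < e; e < \<mu>\<rbrakk> \<Longrightarrow>
      ((\<lambda>\<theta>. 1 / (1 + (\<Sum>s=q..M. R e \<theta> ^ s * a s \<theta>))) has_integral T) {0..2*pi}"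
  shows "integral {0..2*pi} (\<lambda>\<theta>. (a q \<theta>)\<^sup>2) = 0"
proof -
  define c where "c = real (2 * q + 2) / real (q + 2)"
  define \<phi> where "\<phi> = (\<lambda>e \<theta>. 1 / (1 + (\<Sum>s=q..M. R e \<theta> ^ s * a s \<theta>)) - 1 + (\<Sum>s=q..M. e ^ s * a s \<theta>)
      - c * (e ^ (2 * q) * (a q \<theta>)\<^sup>2))"
  define A where "A = (\<lambda>s. integral {0..2*pi} (a s))"
  define Q where "Q = integral {0..2*pi} (\<lambda>\<theta>. (a q \<theta>)\<^sup>2)"
  define F :: "(real \<times> real) filter" where "F = at_right 0 \<times>\<^sub>F principal UNIV"
  have small: "\<forall>\<^sub>F e in at_right 0. 0 < e \<and> e < \<mu>"
    using eventually_at_right_less[of 0] eventually_at_right_field[of "\<lambda>e. e < \<mu>" 0] \<open>0 < \<mu>\<close>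
    by (auto elim: eventually_elim2)
  have lift: "\<forall>\<^sub>F x in F. P x" if "\<And>e \<theta>. \<lbrakk>0 < e; e < \<mu>\<rbrakk> \<Longrightarrow> P (e, \<theta>)" for P
    using small that unfolding F_def eventually_prod_filter eventually_principal by (intro exI conjI) auto
  have e_0: "(fst \<longlongrightarrow> 0) F"
    unfolding F_def by (rule filterlim_mono[OF filterlim_fst _ order_refl]) (simp add: at_within_def)
  have "(\<lambda>x. \<phi> (fst x) (snd x)) \<in> O[F](\<lambda>x. fst x ^ (2 * q + 1))"
    unfolding \<phi>_def c_def
  proof (rule angular_slowness_expansion[OF q(1,2) e_0])
    show "((\<lambda>x. R (fst x) (snd x)) \<longlongrightarrow> 0) F"
    proof (rule tendsto_sandwich[of "\<lambda>_. 0"])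
      show "((\<lambda>x. 2 * fst x) \<longlongrightarrow> 0) F" using tendsto_mult_right_zero[OF e_0] by simp
      show "\<forall>\<^sub>F x in F. 0 \<le> R (fst x) (snd x)" by (rule lift) (use R less_imp_le in auto)
      show "\<forall>\<^sub>F x in F. R (fst x) (snd x) \<le> 2 * fst x" by (rule lift) (use R in auto)
    qed auto
    show "(\<lambda>x. a s (snd x)) \<in> O[F](\<lambda>_. 1)" for s
      using a_bdd by (intro bigoI[of _ "B s"]) simp
  qed (rule lift, use R level in auto)+
  then obtain C where "\<forall>\<^sub>F x in F. norm (\<phi> (fst x) (snd x)) \<le> C * norm (fst x ^ (2 * q + 1))"
    by (elim landau_o.bigE)
  then have bound: "\<forall>\<^sub>F e in at_right 0. \<forall>\<theta>. norm (\<phi> e \<theta>) \<le> C * norm (e ^ (2 * q + 1))"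
    unfolding F_def eventually_prod_filter eventually_principal by (auto elim: eventually_mono)
  define P where "P = [:T - 2 * pi:] + (\<Sum>s=q..M. monom (A s) s) - monom (c * Q) (2 * q)"
  \<comment> \<open>\<open>P\<close> has the unknown number \<open>T - 2 pi\<close> as constant coefficient, so \<open>T\<close> need not be computed.\<close>
  have \<phi>_integral: "(\<phi> e has_integral poly P e) {0..2*pi}" if "0 < e" "e < \<mu>" for e
  proof -
    have "(a s has_integral A s) {0..2*pi}" for s
      unfolding A_def
      by (intro integrable_integral integrable_continuous_real continuous_on_subset[OF a_cont]) auto
    then have "((\<lambda>\<theta>. \<Sum>s=q..M. e ^ s * a s \<theta>) has_integral (\<Sum>s=q..M. e ^ s * A s)) {0..2*pi}"
      by (intro has_integral_sum has_integral_mult_right) auto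
    moreover have "((\<lambda>\<theta>. (a q \<theta>)\<^sup>2) has_integral Q) {0..2*pi}"
      unfolding Q_def
      by (intro integrable_integral integrable_continuous_real continuous_intros continuous_on_subset[OF a_cont]) auto
    then have "((\<lambda>\<theta>. c * (e ^ (2 * q) * (a q \<theta>)\<^sup>2)) has_integral c * (e ^ (2 * q) * Q)) {0..2*pi}"
      by (intro has_integral_mult_right)
    moreover have "((\<lambda>\<theta>. 1 :: real) has_integral 2 * pi) {0..2*pi}"
      using has_integral_const_real[of "1 :: real" 0 "2 * pi"] by simp
    moreover note period[OF that]
    ultimately have "(\<phi> e has_integral T - 2 * pi + (\<Sum>s=q..M. e ^ s * A s) - c * (e ^ (2 * q) * Q)) {0..2*pi}"
      unfolding \<phi>_def by (intro has_integral_add has_integral_diff)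
    then show ?thesis by (simp add: P_def poly_sum poly_monom mult_ac)
  qed
  have "(\<lambda>e. poly P e) \<in> O[at_right 0](\<lambda>e. e ^ (2 * q + 1))"
  proof (rule bigoI[of _ "2 * pi * C"])
    show "\<forall>\<^sub>F e in at_right 0. norm (poly P e) \<le> 2 * pi * C * norm (e ^ (2 * q + 1))"
      using bound small
    proof eventually_elim
      case (elim e)
      have "0 \<le> C * norm (e ^ (2 * q + 1))" using elim(1) norm_ge_zero order_trans by blast
      from has_integral_bound_real[OF this finite.emptyI \<phi>_integral] elim
      show ?case by (simp add: mult_ac)
    qed
  qed
  moreover have "degree P < 2 * q + 1"
  proof -
    have "degree (\<Sum>s=q..M. monom (A s) s) \<le> 2 * q"
      by (rule degree_sum_le) (use q(3) in \<open>auto intro: order_trans[OF degree_monom_le]\<close>)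
    then have "degree P \<le> 2 * q"
      unfolding P_def by (intro degree_diff_le degree_add_le degree_monom_le) auto
    then show ?thesis by simp
  qed
  ultimately have "P = 0" by (rule poly_eq_0_if_small_at_0)
  then have "coeff P (2 * q) = 0" by simp
  moreover have "coeff (\<Sum>s=q..M. monom (A s) s) (2 * q) = 0"
    using q(3) by (auto simp: coeff_sum intro!: sum.neutral)
  moreover have "coeff [:T - 2 * pi:] (2 * q) = 0"
    using q(1) by (cases q) auto
  ultimately have "c * Q = 0" by (simp add: P_def)
  moreover have "c > 0" by (simp add: c_def)
  ultimately show ?thesis by (simp add: Q_def)
qed

section \<open>Polynomial perturbations of the linear center\<close>

text \<open>
  The contribution of the part of degree \<open>s + 1\<close> to the angular speed on the unit circle.
\<close>

definition angular_coeff :: "(int \<Rightarrow> nat \<Rightarrow> complex) \<Rightarrow> nat \<Rightarrow> real \<Rightarrow> real" where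
  "angular_coeff p s \<theta> = Im (X_hom p (Suc s) (cis \<theta>) / cis \<theta>)"

lemma X_hom_polar: "X_hom p r (of_real \<rho> * cis \<theta>) = of_real \<rho> ^ r * X_hom p r (cis \<theta>)"
proof -
  have "p (int r - int j - 1) j * (of_real \<rho> * cis \<theta>) ^ (r - j) * cnj (of_real \<rho> * cis \<theta>) ^ j
      = of_real \<rho> ^ r * (p (int r - int j - 1) j * cis \<theta> ^ (r - j) * cnj (cis \<theta>) ^ j)"
    if "j \<le> r" for j
  proof -
    have "(of_real \<rho> :: complex) ^ r = of_real \<rho> ^ (r - j) * of_real \<rho> ^ j"
      using that by (simp flip: power_add)
    then show ?thesis by (simp add: power_mult_distrib mult_ac)
  qed
  then show ?thesis
    unfolding X_hom_def sum_distrib_left by (intro sum.cong) auto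
qed

lemma X_hom_continuous: "continuous_on A (X_hom p r)"
  unfolding X_hom_def[abs_def] by (intro continuous_intros)

lemma angular_coeff_continuous: "continuous_on A (angular_coeff p s)"
  unfolding angular_coeff_def[abs_def]
  by (intro continuous_intros continuous_on_compose2[OF X_hom_continuous[of UNIV]]) auto

lemma angular_coeff_bounded: "\<exists>B. \<forall>\<theta>. \<bar>angular_coeff p s \<theta>\<bar> \<le> B"
proof (intro exI allI)
  fix \<theta>
  have "\<bar>angular_coeff p s \<theta>\<bar> \<le> norm (X_hom p (Suc s) (cis \<theta>))"
    unfolding angular_coeff_def using abs_Im_le_cmod[of "X_hom p (Suc s) (cis \<theta>) / cis \<theta>"]
    by (simp add: norm_divide)
  also have "\<dots> \<le> (\<Sum>j=0..Suc s. norm (p (int (Suc s) - int j - 1) j))"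
    unfolding X_hom_def by (rule order_trans[OF norm_sum]) (simp add: norm_mult norm_power)
  finally show "\<bar>angular_coeff p s \<theta>\<bar> \<le> (\<Sum>j=0..Suc s. norm (p (int (Suc s) - int j - 1) j))" .
qed

lemma angular_speed_polar:
  assumes "\<rho> \<noteq> 0" and z: "z = of_real \<rho> * cis \<theta>"
    and X: "X = (\<lambda>x. X_lin x + (\<Sum>s\<in>J. X_hom p (Suc s) x))"
  shows "Im (X z / z) = 1 + (\<Sum>s\<in>J. \<rho> ^ s * angular_coeff p s \<theta>)"
proof -
  have "X_hom p (Suc s) z / z = of_real (\<rho> ^ s) * (X_hom p (Suc s) (cis \<theta>) / cis \<theta>)" for s
    using \<open>\<rho> \<noteq> 0\<close> by (simp add: z X_hom_polar)
  then have "X z / z = \<i> + (\<Sum>s\<in>J. of_real (\<rho> ^ s) * (X_hom p (Suc s) (cis \<theta>) / cis \<theta>))"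
    using \<open>\<rho> \<noteq> 0\<close> by (simp add: X X_lin_def add_divide_distrib sum_divide_distrib) (simp add: z)
  then show ?thesis
    by (simp add: angular_coeff_def Im_sum del: of_real_power times_divide_eq_right)
qed

lemma X_hom_at_0: "X_hom p (Suc s) 0 = 0"
  using X_hom_polar[of p "Suc s" 0 0] by simp

text \<open>
  The perturbation has degrees \<open>K + 1\<close> to \<open>M + 1\<close>, so \<open>M < 2 K\<close> is the bound \<open>2 l \<le> 2 k - 2\<close> for
  \<open>k = K + 1\<close>. It passes to the first index \<open>q \<ge> K\<close> at which the angular speed really changes, and
  there it separates the linear from the quadratic terms of the period.
\<close>

lemma nonisochronous_of_small_degree_spread:
  assumes K: "1 \<le> K" "M < 2 * K"
    and X: "X = (\<lambda>x. X_lin x + (\<Sum>s=K..M. X_hom p (Suc s) x))"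
    and ham: "real_hamiltonian X" and nontrivial: "X \<noteq> X_lin"
  shows "nonisochronous X"
proof -
  define a where "a = angular_coeff p"
  obtain H where H_deriv: "\<And>z. (H has_derivative (\<lambda>h. Im (X z * cnj h))) (at z)"
    using real_hamiltonian_complex_gradient[OF ham] by blast
  have X_cont: "continuous_on UNIV X"
    unfolding X X_lin_def by (intro continuous_intros X_hom_continuous)
  have X_0: "X 0 = 0" by (simp add: X X_lin_def X_hom_at_0)
  have speed: "Im (X (of_real \<rho> * cis \<theta>) / (of_real \<rho> * cis \<theta>)) = 1 + (\<Sum>s=K..M. \<rho> ^ s * a s \<theta>)"
    if "\<rho> \<noteq> 0" for \<rho> \<theta>
    unfolding a_def by (rule angular_speed_polar[OF that refl X])
  obtain B where B: "\<And>s \<theta>. \<bar>a s \<theta>\<bar> \<le> B s"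
    unfolding a_def using angular_coeff_bounded[of p] by metis
  define \<delta> where "\<delta> = 1 / (4 * ((\<Sum>s=K..M. B s) + 1))"
  have B_nonneg: "B s \<ge> 0" for s using B[of s 0] by linarith
  then have B_sum: "(\<Sum>s=K..M. B s) \<ge> 0" by (intro sum_nonneg)
  then have \<delta>: "0 < \<delta>" "\<delta> \<le> 1" by (simp_all add: \<delta>_def)
  \<comment> \<open>The radius \<open>\<delta>\<close> is small enough for the angular speed to be at least 3/4 and \<open>H - H 0\<close> at least \<open>\<rho>\<^sup>2/4\<close>.\<close>
  have perturbation: "(\<Sum>s=K..M. \<rho> ^ s * \<bar>a s \<theta>\<bar>) \<le> 1 / 4" if "0 \<le> \<rho>" "\<rho> < \<delta>" for \<rho> \<theta>
  proof -
    have "(\<Sum>s=K..M. \<rho> ^ s * \<bar>a s \<theta>\<bar>) \<le> (\<Sum>s=K..M. \<delta> * B s)"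
    proof (rule sum_mono)
      fix s assume "s \<in> {K..M}"
      then have "\<rho> ^ s \<le> \<rho> ^ 1" using that \<delta> K by (intro power_decreasing) auto
      then show "\<rho> ^ s * \<bar>a s \<theta>\<bar> \<le> \<delta> * B s" using that B by (intro mult_mono) auto
    qed
    also have "\<dots> = \<delta> * (\<Sum>s=K..M. B s)" by (simp add: sum_distrib_left)
    also have "\<dots> \<le> 1 / 4" using B_sum by (simp add: \<delta>_def field_simps)
    finally show ?thesis .
  qed
  have dominated: "\<bar>\<Sum>s=K..M. \<rho> ^ s * a s \<theta> / d s\<bar> \<le> 1 / 4"
    if "0 \<le> \<rho>" "\<rho> < \<delta>" "\<And>s. d s \<ge> 1" for \<rho> \<theta> d
  proof -
    have "\<bar>\<Sum>s=K..M. \<rho> ^ s * a s \<theta> / d s\<bar> \<le> (\<Sum>s=K..M. \<rho> ^ s * \<bar>a s \<theta>\<bar>)"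
    proof (rule order_trans[OF sum_abs], rule sum_mono)
      fix s
      have "\<rho> ^ s * \<bar>a s \<theta>\<bar> / d s \<le> \<rho> ^ s * \<bar>a s \<theta>\<bar> / 1"
        using that by (intro divide_left_mono) (auto intro: less_le_trans[OF zero_less_one])
      then show "\<bar>\<rho> ^ s * a s \<theta> / d s\<bar> \<le> \<rho> ^ s * \<bar>a s \<theta>\<bar>"
        using that(1) order_trans[OF zero_le_one that(3)[of s]] by (simp add: abs_mult)
    qed
    with perturbation[OF that(1,2)] show ?thesis by (meson order_trans)
  qed
  interpret rotating_hamiltonian_field X H \<delta>
  proof
    fix z :: complex assume z: "z \<noteq> 0" "norm z < \<delta>"
    have "z = of_real (norm z) * cis (Arg z)" using rcis_cmod_Arg[of z] by (simp add: rcis_def)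
    then show "Im (X z / z) > 0"
      using speed[of "norm z" "Arg z"] dominated[of "norm z" "\<lambda>_. 1" "Arg z"] z by simp
  qed (use H_deriv X_cont X_0 \<delta> in auto)
  \<comment> \<open>Integrating the radial derivative; both sides agree at \<open>\<rho> = 0\<close>.\<close>
  have H_polar: "H (of_real \<rho> * cis \<theta>) = H 0 + (\<rho>\<^sup>2 / 2 + (\<Sum>s=K..M. \<rho> ^ (s + 2) * a s \<theta> / real (s + 2)))" for \<rho> \<theta>
  proof -
    let ?V = "\<lambda>\<rho>. H (of_real \<rho> * cis \<theta>) - (\<rho>\<^sup>2 / 2 + (\<Sum>s=K..M. \<rho> ^ (s + 2) * a s \<theta> / real (s + 2)))"
    have "(?V has_real_derivative 0) (at \<rho>)" for \<rho>
    proof -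
      have "((\<lambda>\<rho>. \<Sum>s=K..M. \<rho> ^ (s + 2) * a s \<theta> / real (s + 2)) has_real_derivative
          (\<Sum>s=K..M. \<rho> * (\<rho> ^ s * a s \<theta>))) (at \<rho>)"
      proof (rule DERIV_sum)
        fix s
        show "((\<lambda>\<rho>. \<rho> ^ (s + 2) * a s \<theta> / real (s + 2)) has_real_derivative \<rho> * (\<rho> ^ s * a s \<theta>)) (at \<rho>)"
          using DERIV_cdivide[OF DERIV_cmult_right[OF DERIV_pow[of "s + 2" \<rho>], of "a s \<theta>"], of "real (s + 2)"]
          by (simp add: mult_ac del: of_nat_add)
      qed
      moreover have "((\<lambda>\<rho>. \<rho>\<^sup>2 / 2) has_real_derivative \<rho>) (at \<rho>)"
        using DERIV_cdivide[OF DERIV_pow[of 2 \<rho>], of 2] by simp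
      moreover have "\<rho> * Im (X (of_real \<rho> * cis \<theta>) / (of_real \<rho> * cis \<theta>))
          = \<rho> + (\<Sum>s=K..M. \<rho> * (\<rho> ^ s * a s \<theta>))"
        using speed[of \<rho> \<theta>] by (cases "\<rho> = 0") (simp_all add: distrib_left sum_distrib_left)
      ultimately show ?thesis
        using DERIV_diff[OF H_radial_deriv[of \<theta> \<rho>] DERIV_add] by fastforce
    qed
    then have "?V \<rho> = ?V 0" using DERIV_isconst_all by blast
    then show ?thesis by simp
  qed
  \<comment> \<open>Angular speed 1 everywhere forces \<open>H = H 0 + norm z^2 / 2\<close>, and its field is the linear one.\<close>
  have "\<exists>s\<in>{K..M}. \<exists>\<theta>. a s \<theta> \<noteq> 0"
  proof (rule ccontr)
    assume "\<not> ?thesis"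
    then have H_eq: "H (of_real \<rho> * cis \<theta>) = H 0 + \<rho>\<^sup>2 / 2" for \<rho> \<theta>
      using H_polar[of \<rho> \<theta>] by simp
    have "H z = H 0 + ((Re z)\<^sup>2 + (Im z)\<^sup>2) / 2" for z
      using H_eq[of "norm z" "Arg z"] rcis_cmod_Arg[of z] by (simp add: rcis_def cmod_power2)
    then have "H = (\<lambda>z. H 0 + ((Re z)\<^sup>2 + (Im z)\<^sup>2) / 2)" by blast
    moreover have "((\<lambda>z. H 0 + ((Re z)\<^sup>2 + (Im z)\<^sup>2) / 2) has_derivative
        (\<lambda>h. Re z * Re h + Im z * Im h)) (at z)" for z
      by (auto intro!: derivative_eq_intros simp: fun_eq_iff field_simps)
    ultimately have "(H has_derivative (\<lambda>h. Re z * Re h + Im z * Im h)) (at z)" for z by metis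
    from has_derivative_unique[OF H_deriv this]
    have eq: "Im (X z * cnj h) = Re z * Re h + Im z * Im h" for z h by metis
    have "X z = X_lin z" for z
      using eq[of z 1] eq[of z \<i>] by (simp add: X_lin_def complex_eq_iff)
    with nontrivial show False by blast
  qed
  define q where "q = (LEAST s. s \<in> {K..M} \<and> (\<exists>\<theta>. a s \<theta> \<noteq> 0))"
  have "q \<in> {K..M} \<and> (\<exists>\<theta>. a q \<theta> \<noteq> 0)"
    unfolding q_def by (rule LeastI_ex) (use \<open>\<exists>s\<in>{K..M}. _\<close> in blast)
  then obtain \<theta>0 where q: "K \<le> q" "q \<le> M" and \<theta>0: "a q \<theta>0 \<noteq> 0" by auto
  have below_q: "a s \<theta> = 0" if "s \<in> {K..M}" "s < q" for s \<theta>
    using not_less_Least[of s] that unfolding q_def by blast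
  have sum_q: "(\<Sum>s=K..M. f s) = (\<Sum>s=q..M. f s)" if "\<And>s. a s \<theta> = 0 \<Longrightarrow> f s = 0" for f :: "nat \<Rightarrow> real" and \<theta>
    using q that below_q by (intro sum.mono_neutral_right) (auto simp: not_le)
  have "\<not> isochronous X"
  proof
    assume "isochronous X"
    then obtain T R \<mu> where "\<mu> > 0" and R: "\<And>e \<theta>. \<lbrakk>0 < e; e < \<mu>\<rbrakk> \<Longrightarrow>
        0 < R e \<theta> \<and> R e \<theta> < \<delta> \<and> H (of_real (R e \<theta>) * cis \<theta>) = H 0 + e\<^sup>2 / 2"
      and T: "\<And>e. \<lbrakk>0 < e; e < \<mu>\<rbrakk> \<Longrightarrow> ((\<lambda>\<theta>. 1 / Im (X (of_real (R e \<theta>) * cis \<theta>) /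
        (of_real (R e \<theta>) * cis \<theta>))) has_integral T) {0..2*pi}"
      by (rule isochronous_imp_constant_period_integral) blast
    have level: "(R e \<theta>)\<^sup>2 / 2 + (\<Sum>s=K..M. R e \<theta> ^ (s + 2) * a s \<theta> / real (s + 2)) = e\<^sup>2 / 2"
      if "0 < e" "e < \<mu>" for e \<theta>
      using R[OF that, of \<theta>] H_polar[of "R e \<theta>" \<theta>] by simp
    have "integral {0..2*pi} (\<lambda>\<theta>. (a q \<theta>)\<^sup>2) = 0"
    proof (rule constant_period_imp_square_integral_zero[where M = M and \<mu> = \<mu> and B = B and R = R and T = T])
      show "continuous_on UNIV (a s)" for s unfolding a_def by (rule angular_coeff_continuous)
      fix e \<theta> :: real assume e: "0 < e" "e < \<mu>"
      have "(\<Sum>s=K..M. R e \<theta> ^ (s + 2) * a s \<theta> / real (s + 2))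
          = (R e \<theta>)\<^sup>2 * (\<Sum>s=K..M. R e \<theta> ^ s * a s \<theta> / real (s + 2))"
        by (simp add: sum_distrib_left power_add power2_eq_square mult_ac)
      moreover have "(R e \<theta>)\<^sup>2 * (- 1 / 4) \<le> (R e \<theta>)\<^sup>2 * (\<Sum>s=K..M. R e \<theta> ^ s * a s \<theta> / real (s + 2))"
        using dominated[of "R e \<theta>" "\<lambda>s. real (s + 2)" \<theta>] R[OF e, of \<theta>]
        by (intro mult_left_mono) (auto simp: abs_le_iff less_imp_le)
      ultimately have "(R e \<theta>)\<^sup>2 \<le> 2 * e\<^sup>2" using level[OF e, of \<theta>] by simp
      also have "\<dots> \<le> (2 * e)\<^sup>2" by (simp add: power_mult_distrib)
      finally have "R e \<theta> \<le> 2 * e" by (rule power2_le_imp_le) (use e in simp)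
      then show "0 < R e \<theta> \<and> R e \<theta> \<le> 2 * e" using R[OF e] by simp
      show "(R e \<theta>)\<^sup>2 / 2 + (\<Sum>s=q..M. R e \<theta> ^ (s + 2) * a s \<theta> / real (s + 2)) = e\<^sup>2 / 2"
        using level[OF e, of \<theta>] by (subst (asm) sum_q[of \<theta>]) auto
    next
      fix e :: real assume e: "0 < e" "e < \<mu>"
      have "Im (X (of_real (R e \<theta>) * cis \<theta>) / (of_real (R e \<theta>) * cis \<theta>))
          = 1 + (\<Sum>s=q..M. R e \<theta> ^ s * a s \<theta>)" for \<theta>
        using R[OF e, of \<theta>] by (subst speed) (auto intro: sum_q[of \<theta>])
      with T[OF e] show "((\<lambda>\<theta>. 1 / (1 + (\<Sum>s=q..M. R e \<theta> ^ s * a s \<theta>))) has_integral T) {0..2*pi}"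
        by simp
    qed (use q K B \<open>\<mu> > 0\<close> in auto)
    moreover have "continuous_on {0..2*pi} (\<lambda>\<theta>. (a q \<theta>)\<^sup>2)"
      unfolding a_def by (intro continuous_intros angular_coeff_continuous)
    ultimately have zero: "a q \<theta> = 0" if "\<theta> \<in> {0..2*pi}" for \<theta>
      using integral_eq_0_iff[of 0 "2 * pi" "\<lambda>\<theta>. (a q \<theta>)\<^sup>2"] that by simp
    \<comment> \<open>The value of \<open>a q\<close> depends on the angle only through \<open>cis\<close>, so one turn covers all angles.\<close>
    define \<theta>1 where "\<theta>1 = Arg2pi (cis \<theta>0)"
    have "cis \<theta>0 = cis \<theta>1"
      using Arg2pi_eq[of "cis \<theta>0"] by (simp add: \<theta>1_def cis_conv_exp)
    then have "a q \<theta>0 = a q \<theta>1" by (simp add: a_def angular_coeff_def)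
    moreover have "\<theta>1 \<in> {0..2*pi}"
      using Arg2pi_ge_0[of "cis \<theta>0"] Arg2pi_lt_2pi[of "cis \<theta>0"] by (simp add: \<theta>1_def)
    ultimately show False using zero \<theta>0 by simp
  qed
  with center show ?thesis by (simp add: nonisochronous_def)
qed

theorem theorem2:
  fixes k l :: int
    and p :: "int \<Rightarrow> nat \<Rightarrow> complex"
    and X :: "complex \<Rightarrow> complex"
  assumes "k \<ge> 2" and "l \<le> k - 1"
    and "X = (\<lambda>x. X_lin x + (\<Sum>r = nat k..nat (2 * l). X_hom p r x))"
    and "real_hamiltonian X"
    and "X \<noteq> X_lin"
  shows "nonisochronous X"
proof (rule nonisochronous_of_small_degree_spread)
  \<comment> \<open>An empty sum would make \<open>X\<close> linear; hence both bounds are positive and can be shifted down by one.\<close>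
  have "nat k \<le> nat (2 * l)"
  proof (rule ccontr)
    assume "\<not> ?thesis"
    then have "X = X_lin" using assms(3) by simp
    with assms(5) show False ..
  qed
  then have k: "nat k = Suc (nat k - 1)" and l: "nat (2 * l) = Suc (nat (2 * l) - 1)"
    using assms(1) by auto
  show "X = (\<lambda>x. X_lin x + (\<Sum>s = nat k - 1..nat (2 * l) - 1. X_hom p (Suc s) x))"
    unfolding assms(3) by (subst k, subst l, subst sum.shift_bounds_cl_Suc_ivl) (rule refl)
qed (use assms in auto)

end
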